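(* Let $\alpha,\beta$ be partitions with $|\alpha|=|\beta|$ and let $k\in\mathbb{Z}_{\ge0}$. If $\alpha=\mu_{(k)}$ and $\beta=(\mu')_{(k)}$ for some partition $\mu$, then $X_{\alpha,\beta,k}$ contains exactly one element, and this element has sign $(-1)^{|\mu|}$.
   Context: Partitions are identified with their Young diagrams (English notation; box $(i,j)$ is in row $i$, column $j$). $\mu'$ is the conjugate (transpose) of $\mu$, $\ell(\mu)$ its number of nonzero rows, $|\mu|$ its size, and $\emptyset$ the empty partition. The rank $r(\mu)$ is the greatest integer $k\ge 0$ with $\mu_k\ge k$ (side length of the Durfee square; $r(\emptyset)=0$). The $k$-stabilization $\mu_{(k)}$ is the partition obtained from $\mu$ by adding $k$ rows of length $r(\mu)$ (inserted so that the rows remain weakly decreasing). For partitions $\nu\subseteq\alpha$, a tableau of skew shape $\alpha/\nu$ is a filling of the boxes of $\alpha$ not in $\nu$ with positive integers; it is semistandard if rows weakly increase left to right and columns strictly increase top to bottom. Its content is $(c_1,c_2,\dots)$ with $c_i$ the number of labels equal to $i$. Its reverse reading word is obtained by reading the rows right to left, from top to bottom. A word is lattice if for every $i\ge1$ each initial segment contains at least as many $i$'s as $(i+1)$'s. A Littlewood--Richardson tableau is a semistandard tableau whose reverse reading word is lattice. $\mathrm{LR}(\alpha/\nu,\lambda)$ denotes the set of Littlewood--Richardson tableaux of shape $\alpha/\nu$ and content $\lambda$ (empty if $\nu\not\subseteq\alpha$). For partitions $\alpha,\beta$ with $|\alpha|=|\beta|$ and $k\ge0$, define $$X_{\alpha,\beta}(\lambda,\nu)=\mathrm{LR}(\alpha/\nu,\lambda)\times\mathrm{LR}(\beta/\nu',\lambda),\qquad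 X_{\alpha,\beta,k}=\bigsqcup_{\lambda,\nu:\ \ell(\lambda)\le k}X_{\alpha,\beta}(\lambda,\nu),$$ where $\lambda,\nu$ range over partitions. The sign of $\chi\in X_{\alpha,\beta}(\lambda,\nu)$ is $\operatorname{sgn}(\chi)=(-1)^{|\nu|}$. *)

theory Defs
  imports "HOL-Library.FuncSet"
begin

text \<open>A partition is the weakly decreasing list of its nonzero parts, so its number of nonzero
  rows is its length and its size is its sum. Rows, columns and labels are numbered from 1.\<close>

definition is_partition :: "nat list \<Rightarrow> bool" where
  "is_partition mu \<longleftrightarrow> sorted_wrt (\<ge>) mu \<and> 0 \<notin> set mu"

definition part :: "nat list \<Rightarrow> nat \<Rightarrow> nat" where
  "part mu i = (if 1 \<le> i \<and> i \<le> length mu then mu ! (i - 1) else 0)"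

definition diagram :: "nat list \<Rightarrow> (nat \<times> nat) set" where
  "diagram mu = {(i, j). 1 \<le> i \<and> 1 \<le> j \<and> j \<le> part mu i}"

definition conj_partition :: "nat list \<Rightarrow> nat list" where
  "conj_partition mu = map (\<lambda>j. card {i. (i, j) \<in> diagram mu}) [1..<Suc (part mu 1)]"

text \<open>The value \<open>k = 0\<close> always qualifies, since \<open>part mu 0 = 0\<close>.\<close>

definition durfee_rank :: "nat list \<Rightarrow> nat" where
  "durfee_rank mu = (GREATEST k. k \<le> part mu k)"

text \<open>The filter matters only for the empty partition, where the added rows have length 0.\<close>

definition stabilization :: "nat \<Rightarrow> nat list \<Rightarrow> nat list" where
  "stabilization k mu = rev (sort (filter (\<lambda>x. x > 0) (mu @ replicate k (durfee_rank mu))))"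

definition skew_shape :: "nat list \<Rightarrow> nat list \<Rightarrow> (nat \<times> nat) set" where
  "skew_shape al nu = diagram al - diagram nu"

definition skew_tableaux :: "nat list \<Rightarrow> nat list \<Rightarrow> (nat \<times> nat \<Rightarrow> nat) set" where
  "skew_tableaux al nu = (skew_shape al nu \<rightarrow>\<^sub>E {1..})"

definition semistandard :: "nat list \<Rightarrow> nat list \<Rightarrow> (nat \<times> nat \<Rightarrow> nat) \<Rightarrow> bool" where
  "semistandard al nu T \<longleftrightarrow>
     (\<forall>i j j'. (i, j) \<in> skew_shape al nu \<longrightarrow> (i, j') \<in> skew_shape al nu \<longrightarrow> j < j' \<longrightarrow>
        T (i, j) \<le> T (i, j')) \<and>
     (\<forall>i i' j. (i, j) \<in> skew_shape al nu \<longrightarrow> (i', j) \<in> skew_shape al nu \<longrightarrow> i < i' \<longrightarrow>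
        T (i, j) < T (i', j))"

definition tableau_content :: "nat list \<Rightarrow> nat list \<Rightarrow> (nat \<times> nat \<Rightarrow> nat) \<Rightarrow> nat \<Rightarrow> nat" where
  "tableau_content al nu T c = card {b \<in> skew_shape al nu. T b = c}"

definition reverse_reading_word ::
  "nat list \<Rightarrow> nat list \<Rightarrow> (nat \<times> nat \<Rightarrow> nat) \<Rightarrow> nat list" where
  "reverse_reading_word al nu T =
     concat (map (\<lambda>i. map (\<lambda>j. T (i, j)) (rev [Suc (part nu i)..<Suc (part al i)]))
       [1..<Suc (length al)])"

definition lattice_word :: "nat list \<Rightarrow> bool" where
  "lattice_word w \<longleftrightarrow>
     (\<forall>c\<ge>1. \<forall>n. count_list (take n w) (Suc c) \<le> count_list (take n w) c)"

definition LR :: "nat list \<Rightarrow> nat list \<Rightarrow> nat list \<Rightarrow> (nat \<times> nat \<Rightarrow> nat) set" where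
  "LR al nu lam =
     {T \<in> skew_tableaux al nu. diagram nu \<subseteq> diagram al \<and> semistandard al nu T \<and>
        lattice_word (reverse_reading_word al nu T) \<and>
        (\<forall>c\<ge>1. tableau_content al nu T c = part lam c)}"

type_synonym tableau_pair =
  "(nat list \<times> nat list) \<times> ((nat \<times> nat \<Rightarrow> nat) \<times> (nat \<times> nat \<Rightarrow> nat))"

definition X_pairs ::
  "nat list \<Rightarrow> nat list \<Rightarrow> nat list \<Rightarrow> nat list \<Rightarrow> ((nat \<times> nat \<Rightarrow> nat) \<times> (nat \<times> nat \<Rightarrow> nat)) set"
  where "X_pairs al be lam nu = LR al nu lam \<times> LR be (conj_partition nu) lam"

text \<open>The disjoint union is rendered by tagging each pair of tableaux with \<open>(lam, nu)\<close>.\<close>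

definition X_set :: "nat list \<Rightarrow> nat list \<Rightarrow> nat \<Rightarrow> tableau_pair set" where
  "X_set al be k =
     Sigma {(lam, nu). is_partition lam \<and> is_partition nu \<and> length lam \<le> k}
       (\<lambda>(lam, nu). X_pairs al be lam nu)"

definition pair_sign :: "tableau_pair \<Rightarrow> int" where
  "pair_sign chi = (case chi of ((lam, nu), _) \<Rightarrow> (-1) ^ sum_list nu)"

end

theory Submission
  imports Defs
begin

text \<open>Since \<open>\<lambda>\<close> has at most \<open>k\<close> rows, labels are at most \<open>k\<close>, so no column of \<open>\<alpha>/\<nu>\<close> or of
  \<open>\<beta>/\<nu>'\<close> is longer than \<open>k\<close>. Let \<open>r\<close> be the rank of \<open>\<mu>\<close>. In its first \<open>r\<close> columns \<open>\<alpha>\<close> exceeds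
  \<open>\<mu>\<close> by exactly \<open>k\<close> boxes, so \<open>\<nu>\<close> contains \<open>\<mu>\<close> there; the same argument for \<open>\<beta>\<close> handles the first
  \<open>r\<close> rows, and every box of \<open>\<mu>\<close> lies in one of these rows or columns. Conversely \<open>\<nu> \<subseteq> \<alpha>\<close> bounds
  \<open>\<nu>\<close> by \<open>\<mu>\<close> right of column \<open>r\<close>, and \<open>\<nu>' \<subseteq> \<beta>\<close> bounds it below row \<open>r\<close>. Hence \<open>\<nu> = \<mu>\<close>. Now
  \<open>\<alpha>/\<mu>\<close> has \<open>r\<close> columns of length exactly \<open>k\<close>, each of which must be filled with \<open>1, \<dots>, k\<close>.\<close>

section \<open>Diagrams and conjugates\<close>

text \<open>In a weakly decreasing list the parts that are at least \<open>j\<close> form an initial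
  block, so the filter length is the height of column \<open>j\<close>. Heights in this form do not
  depend on the order of the list, which is what makes the sorting in \<open>stabilization\<close>
  harmless.\<close>

lemma le_part_iff_le_length_filter:
  assumes "sorted_wrt (\<ge>) mu" "1 \<le> i" "1 \<le> j"
  shows "j \<le> part mu i \<longleftrightarrow> i \<le> length (filter ((\<le>) j) mu)"
  using assms
proof (induction mu arbitrary: i)
  case Nil
  then show ?case by (simp add: part_def)
next
  case (Cons x xs)
  have empty: "filter ((\<le>) j) xs = []" if "\<not> j \<le> x"
    using Cons.prems that by (auto simp: filter_empty_conv)
  show ?case
  proof (cases "i = 1")
    case True
    then show ?thesis using empty by (auto simp: part_def)
  next
    case False
    then obtain i' where "i = Suc (Suc i')"
      using Cons.prems(2) by (cases i rule: nat.exhaust; cases "i - 1") auto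
    then have "part (x # xs) i = part xs (i - 1)" by (simp add: part_def)
    moreover have "j \<le> part xs (i - 1) \<longleftrightarrow> i - 1 \<le> length (filter ((\<le>) j) xs)"
      using Cons.IH[of "i - 1"] Cons.prems False by simp
    ultimately show ?thesis using empty False Cons.prems by auto
  qed
qed

lemma finite_diagram: "finite (diagram mu)"
proof -
  have "diagram mu \<subseteq> (SIGMA i:{1..length mu}. {1..part mu i})"
    by (auto simp: diagram_def part_def split: if_splits)
  then show ?thesis by (rule finite_subset) auto
qed

lemma is_partition_sorted: "is_partition mu \<Longrightarrow> sorted_wrt (\<ge>) mu"
  by (simp add: is_partition_def)

lemma diagram_iff_le_length_filter:
  assumes "is_partition mu"
  shows "(i, j) \<in> diagram mu \<longleftrightarrow> 1 \<le> i \<and> 1 \<le> j \<and> i \<le> length (filter ((\<le>) j) mu)"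
  using le_part_iff_le_length_filter[OF is_partition_sorted[OF assms]] by (auto simp: diagram_def)

lemma card_column:
  assumes "is_partition mu" "1 \<le> j"
  shows "card {i. (i, j) \<in> diagram mu} = length (filter ((\<le>) j) mu)"
proof -
  have "{i. (i, j) \<in> diagram mu} = {1..length (filter ((\<le>) j) mu)}"
    using assms by (auto simp: diagram_iff_le_length_filter)
  then show ?thesis by simp
qed

lemma part_conj_partition:
  assumes "is_partition mu" "1 \<le> j"
  shows "part (conj_partition mu) j = length (filter ((\<le>) j) mu)"
proof (cases "j \<le> part mu 1")
  case True
  then have "part (conj_partition mu) j = card {i. (i, j) \<in> diagram mu}"
    using assms(2) unfolding conj_partition_def part_def[of "map _ _"]
    using nth_upt[of 1 "j - 1" "Suc (part mu 1)"] by (simp del: upt_Suc)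
  then show ?thesis using card_column[OF assms] by simp
next
  case False
  then have "length (filter ((\<le>) j) mu) = 0"
    using le_part_iff_le_length_filter[OF is_partition_sorted[OF assms(1)], of 1 j] assms(2) by linarith
  moreover have "part (conj_partition mu) j = 0"
    using False by (simp add: part_def conj_partition_def)
  ultimately show ?thesis by simp
qed

lemma diagram_iff_le_part_conj:
  assumes "is_partition mu"
  shows "(i, j) \<in> diagram mu \<longleftrightarrow> 1 \<le> i \<and> 1 \<le> j \<and> i \<le> part (conj_partition mu) j"
  using diagram_iff_le_length_filter[OF assms] part_conj_partition[OF assms] by auto

lemma diagram_conj_partition:
  assumes "is_partition mu"
  shows "(i, j) \<in> diagram (conj_partition mu) \<longleftrightarrow> (j, i) \<in> diagram mu"
  using diagram_iff_le_part_conj[OF assms] by (auto simp: diagram_def)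

lemma length_filter_ge_antimono:
  fixes xs :: "nat list"
  assumes "a \<le> b"
  shows "length (filter ((\<le>) b) xs) \<le> length (filter ((\<le>) a) xs)"
  using assms by (induction xs) auto

lemma is_partition_conj_partition:
  assumes "is_partition mu"
  shows "is_partition (conj_partition mu)"
proof -
  have eq: "conj_partition mu = map (\<lambda>j. length (filter ((\<le>) j) mu)) [1..<Suc (part mu 1)]"
    unfolding conj_partition_def using card_column[OF assms] by (intro map_cong) auto
  have "sorted_wrt (\<ge>) (conj_partition mu)"
    unfolding eq by (auto simp: sorted_wrt_iff_nth_less simp del: upt_Suc intro!: length_filter_ge_antimono)
  moreover have "length (filter ((\<le>) j) mu) \<noteq> 0" if "1 \<le> j" "j \<le> part mu 1" for j
    using le_part_iff_le_length_filter[OF is_partition_sorted[OF assms], of 1 j] that by auto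
  then have "0 \<notin> set (conj_partition mu)"
    unfolding eq by (force simp del: upt_Suc)
  ultimately show ?thesis by (simp add: is_partition_def)
qed

lemma diagram_down_closed:
  assumes "is_partition mu" "(i, j) \<in> diagram mu" "1 \<le> i'" "i' \<le> i" "1 \<le> j'" "j' \<le> j"
  shows "(i', j') \<in> diagram mu"
  using assms length_filter_ge_antimono[of j' j mu]
  by (auto simp: diagram_iff_le_length_filter)

lemma part_eqI:
  assumes "is_partition mu" "is_partition nu" "\<And>i. 1 \<le> i \<Longrightarrow> part mu i = part nu i"
  shows "mu = nu"
proof -
  \<comment> \<open>The list has no zero entries, so the sequence of parts determines its
    length.\<close>
  have pos: "part xs i > 0 \<longleftrightarrow> i \<le> length xs" if "is_partition xs" "1 \<le> i" for xs i
  proof -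
    have "0 < xs ! (i - 1)" if "i \<le> length xs"
      using \<open>is_partition xs\<close> \<open>1 \<le> i\<close> that nth_mem[of "i - 1" xs]
      by (metis (no_types, lifting) Suc_diff_1 gr0I is_partition_def less_eq_Suc_le
          One_nat_def)
    then show ?thesis using \<open>1 \<le> i\<close> by (auto simp: part_def)
  qed
  have "i \<le> length mu \<longleftrightarrow> i \<le> length nu" if "1 \<le> i" for i
    using pos[OF assms(1) that] pos[OF assms(2) that] assms(3)[OF that] by simp
  from this[of "length mu"] this[of "length nu"] have len: "length mu = length nu"
    by (cases "length mu"; cases "length nu") auto
  show ?thesis
  proof (rule nth_equalityI[OF len])
    fix i assume "i < length mu"
    then show "mu ! i = nu ! i" using assms(3)[of "Suc i"] len by (simp add: part_def)
  qed
qed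

lemma diagram_inject:
  assumes "is_partition mu" "is_partition nu" "diagram mu = diagram nu"
  shows "mu = nu"
proof (rule part_eqI[OF assms(1,2)])
  fix i :: nat assume i: "1 \<le> i"
  have "j \<le> part mu i \<longleftrightarrow> j \<le> part nu i" for j
  proof (cases "j = 0")
    case False
    have "(i, j) \<in> diagram mu \<longleftrightarrow> (i, j) \<in> diagram nu" using assms(3) by simp
    then show ?thesis using i False by (simp add: diagram_def)
  qed simp
  then show "part mu i = part nu i" by (meson order_antisym order_refl)
qed

section \<open>Rank and stabilization\<close>

text \<open>Describing the rank by diagonal boxes makes it visibly invariant under
  transposition.\<close>

lemma diagonal_iff_durfee_rank:
  assumes "is_partition mu"
  shows "(i, i) \<in> diagram mu \<longleftrightarrow> 1 \<le> i \<and> i \<le> durfee_rank mu"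
proof -
  \<comment> \<open>\<open>GREATEST\<close> is meaningful only for a bounded predicate with a
    witness: the bound is \<open>length mu\<close>, the witness 0.\<close>
  have bd: "\<forall>y. y \<le> part mu y \<longrightarrow> y \<le> length mu"
    by (auto simp: part_def split: if_splits)
  have r: "durfee_rank mu \<le> part mu (durfee_rank mu)"
    unfolding durfee_rank_def by (rule GreatestI_nat[of _ 0]) (use bd in auto)
  have ub: "i \<le> durfee_rank mu" if "i \<le> part mu i" for i
    unfolding durfee_rank_def by (rule Greatest_le_nat) (use bd that in auto)
  have "(i, i) \<in> diagram mu" if "1 \<le> i" "i \<le> durfee_rank mu"
  proof (rule diagram_down_closed[OF assms])
    show "(durfee_rank mu, durfee_rank mu) \<in> diagram mu"
      using r that by (simp add: diagram_def)
  qed (use that in auto)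
  moreover have "1 \<le> i \<and> i \<le> durfee_rank mu" if "(i, i) \<in> diagram mu"
    using that ub[of i] by (simp add: diagram_def)
  ultimately show ?thesis by blast
qed

lemma durfee_rank_conj_partition:
  assumes "is_partition mu"
  shows "durfee_rank (conj_partition mu) = durfee_rank mu"
proof -
  have "1 \<le> i \<and> i \<le> durfee_rank (conj_partition mu) \<longleftrightarrow> 1 \<le> i \<and> i \<le> durfee_rank mu" for i
    using diagonal_iff_durfee_rank[OF assms]
      diagonal_iff_durfee_rank[OF is_partition_conj_partition[OF assms]]
      diagram_conj_partition[OF assms] by metis
  from this[of "durfee_rank mu"] this[of "durfee_rank (conj_partition mu)"] show ?thesis
    by linarith
qed

lemma is_partition_stabilization: "is_partition (stabilization k mu)"
  by (auto simp: is_partition_def stabilization_def sorted_wrt_rev)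

lemma length_filter_stabilization:
  assumes "1 \<le> j"
  shows "length (filter ((\<le>) j) (stabilization k mu)) =
    length (filter ((\<le>) j) mu) + (if j \<le> durfee_rank mu then k else 0)"
proof -
  have "length (filter ((\<le>) j) (rev (sort xs))) = length (filter ((\<le>) j) xs)" for xs
    by (simp add: filter_sort flip: rev_filter)
  moreover have "filter ((\<le>) j) (filter (\<lambda>x. x > 0) xs) = filter ((\<le>) j) xs" for xs
    using assms by (auto simp: filter_filter intro!: filter_cong)
  ultimately show ?thesis
    by (simp add: stabilization_def del: filter_append filter_filter) simp
qed

text \<open>Inserting \<open>k\<close> rows of length \<open>r\<close>, the rank, lengthens each of
  the first \<open>r\<close> columns by \<open>k\<close> and leaves the others alone, wherever
  sorting puts these rows.\<close>

lemma diagram_stabilization: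
  assumes "is_partition mu"
  shows "(i, j) \<in> diagram (stabilization k mu) \<longleftrightarrow>
    1 \<le> i \<and> 1 \<le> j \<and> i \<le> part (conj_partition mu) j + (if j \<le> durfee_rank mu then k else 0)"
  using diagram_iff_le_length_filter[OF is_partition_stabilization]
    length_filter_stabilization part_conj_partition[OF assms] by (metis (no_types, lifting))

section \<open>Littlewood--Richardson tableaux with few labels\<close>

lemma finite_skew_shape: "finite (skew_shape al nu)"
  by (simp add: skew_shape_def finite_diagram)

text \<open>A label that occurs has nonzero multiplicity, so it indexes an actual row of
  \<open>lam\<close>.\<close>

lemma LR_label_le:
  assumes "T \<in> LR al nu lam" "b \<in> skew_shape al nu"
  shows "T b \<in> {1..length lam}"
proof -
  have pos: "1 \<le> T b"
    using assms PiE_mem[of T "skew_shape al nu" "\<lambda>_. {1..}" b] by (simp add: LR_def skew_tableaux_def)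
  have "{b' \<in> skew_shape al nu. T b' = T b} \<noteq> {}" using assms(2) by blast
  moreover have "finite {b' \<in> skew_shape al nu. T b' = T b}"
    by (rule finite_subset[OF _ finite_skew_shape]) auto
  ultimately have "tableau_content al nu T (T b) \<noteq> 0"
    unfolding tableau_content_def by (metis card_0_eq)
  then have "part lam (T b) \<noteq> 0" using assms(1) pos by (auto simp: LR_def)
  then show ?thesis using pos by (auto simp: part_def split: if_splits)
qed

lemma LR_column_strict:
  assumes "T \<in> LR al nu lam" "(i, j) \<in> skew_shape al nu" "(i', j) \<in> skew_shape al nu" "i < i'"
  shows "T (i, j) < T (i', j)"
  using assms by (auto simp: LR_def semistandard_def)

text \<open>Labels in a column are distinct elements of \<open>{1..length lam}\<close>, so the skew
  column has at most \<open>length lam\<close> boxes.\<close>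

lemma LR_column_height:
  assumes "T \<in> LR al nu lam" "is_partition al" "is_partition nu"
  shows "part (conj_partition al) j \<le> part (conj_partition nu) j + length lam"
proof (cases "j = 0")
  case True
  then show ?thesis by (simp add: part_def)
next
  case False
  let ?I = "{part (conj_partition nu) j <.. part (conj_partition al) j}"
  have mem: "(i, j) \<in> skew_shape al nu" if "i \<in> ?I" for i
    using that False diagram_iff_le_part_conj[OF assms(2)] diagram_iff_le_part_conj[OF assms(3)]
    by (auto simp: skew_shape_def)
  have "inj_on (\<lambda>i. T (i, j)) ?I"
    using LR_column_strict[OF assms(1) mem mem]
    by (intro linorder_inj_onI) (metis less_irrefl, auto)
  moreover have "(\<lambda>i. T (i, j)) ` ?I \<subseteq> {1..length lam}"
    using LR_label_le[OF assms(1) mem] by blast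
  ultimately have "card ?I \<le> card {1..length lam}" by (intro card_inj_on_le) auto
  then show ?thesis by simp
qed

lemma strict_increasing_into_interval:
  fixes f :: "nat \<Rightarrow> nat"
  assumes mono: "\<And>i i'. m < i \<Longrightarrow> i < i' \<Longrightarrow> i' \<le> m + k \<Longrightarrow> f i < f i'"
    and range: "\<And>i. m < i \<Longrightarrow> i \<le> m + k \<Longrightarrow> f i \<in> {1..k}"
    and i: "m < i" "i \<le> m + k"
  shows "f i = i - m"
proof (rule antisym)
  \<comment> \<open>Descending from the top end, where \<open>f\<close> is at most \<open>k\<close>,
    each step loses at least 1; the lower bound climbs from the bottom end in the same way.\<close>
  have "f (m + k - t) \<le> k - t" if "t < k" for t
    using that
  proof (induction t)
    case 0
    then show ?case using range[of "m + k"] by auto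
  next
    case (Suc t)
    then have "f (m + k - Suc t) < f (m + k - t)" by (intro mono) auto
    with Suc show ?case by auto
  qed
  from this[of "m + k - i"] show "f i \<le> i - m" using i by auto
  have "Suc t \<le> f (m + Suc t)" if "t < k" for t
    using that
  proof (induction t)
    case 0
    then show ?case using range[of "Suc m"] by auto
  next
    case (Suc t)
    then show ?case using mono[of "m + Suc t" "m + Suc (Suc t)"] by auto
  qed
  from this[of "i - m - 1"] show "i - m \<le> f i" using i by (simp add: Suc_diff_Suc)
qed

text \<open>Each occurrence of \<open>c + 1\<close> in a block is paid for by a \<open>c\<close> in
  the preceding block, hence by one already read in full. So the inequality holds even for a prefix
  that ends inside a block.\<close>

lemma lattice_word_concat:
  assumes first: "\<And>c. 1 \<le> c \<Longrightarrow> count_list (f 1) (Suc c) = 0"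
    and step: "\<And>c i. 1 \<le> c \<Longrightarrow> 1 \<le> i \<Longrightarrow> count_list (f (Suc i)) (Suc c) \<le> count_list (f i) c"
  shows "lattice_word (concat (map f [1..<Suc n]))"
  unfolding lattice_word_def
proof (intro allI impI)
  fix c m :: nat assume c: "1 \<le> c"
  define W where "W n = concat (map f [1..<Suc n])" for n
  have W_Suc: "W (Suc n) = W n @ f (Suc n)" for n by (simp add: W_def)
  have full: "count_list (W (Suc n)) (Suc c) \<le> count_list (W n) c" for n
  proof (induction n)
    case 0
    then show ?case using first[OF c] by (simp add: W_def)
  next
    case (Suc n)
    then show ?case using step[OF c, of "Suc n"] W_Suc[of "Suc n"] W_Suc[of n] by simp
  qed
  have take_le: "count_list (take p xs) x \<le> count_list xs x" for p xs and x :: nat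
    using count_list_append[of "take p xs" "drop p xs" x] by simp
  have "count_list (take m (W n)) (Suc c) \<le> count_list (take m (W n)) c"
  proof (induction n)
    case 0
    then show ?case by (simp add: W_def)
  next
    case (Suc n)
    show ?case
    proof (cases "m \<le> length (W n)")
      case True
      then show ?thesis using Suc by (simp add: W_Suc)
    next
      case False
      \<comment> \<open>The prefix reaches beyond \<open>W n\<close>, so it contains every
        \<open>c\<close> of \<open>W n\<close>; these already outnumber the \<open>c + 1\<close> of
        all of \<open>W (Suc n)\<close>.\<close>
      have "count_list (take m (W (Suc n))) (Suc c) \<le> count_list (W (Suc n)) (Suc c)"
        by (rule take_le)
      also have "\<dots> \<le> count_list (W n) c" by (rule full)
      also have "\<dots> \<le> count_list (take m (W (Suc n))) c" using False by (simp add: W_Suc)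
      finally show ?thesis .
    qed
  qed
  then show "count_list (take m (concat (map f [1..<Suc n]))) (Suc c)
      \<le> count_list (take m (concat (map f [1..<Suc n]))) c"
    by (simp add: W_def)
qed

lemma count_list_map_distinct:
  assumes "distinct xs"
  shows "count_list (map f xs) c = card {x \<in> set xs. f x = c}"
proof -
  have "count_list (map f xs) c = length (filter (\<lambda>x. f x = c) xs)"
    by (induction xs) auto
  also have "\<dots> = card {x \<in> set xs. f x = c}"
    using assms by (metis distinct_card distinct_filter set_filter)
  finally show ?thesis .
qed

section \<open>Tableaux on a stabilization\<close>

text \<open>The label of a box is its position within its column of the skew shape, so each column
  reads 1, ..., \<open>k\<close> downwards. Restriction gives the default value outside the shape
  that \<open>skew_tableaux\<close> demands.\<close>

definition column_tableau :: "nat \<Rightarrow> nat list \<Rightarrow> nat \<times> nat \<Rightarrow> nat" where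
  "column_tableau k mu =
     restrict (\<lambda>(i, j). i - part (conj_partition mu) j) (skew_shape (stabilization k mu) mu)"

text \<open>As in \<open>stabilization\<close>, the filter only removes rows of length 0.\<close>

definition rectangle :: "nat \<Rightarrow> nat \<Rightarrow> nat list" where
  "rectangle k r = filter (\<lambda>x. x > 0) (replicate k r)"

lemma rectangle: "is_partition (rectangle k r)" "length (rectangle k r) \<le> k"
  by (cases "r = 0"; simp add: is_partition_def rectangle_def sorted_wrt_iff_nth_less)+

lemma part_rectangle: "1 \<le> c \<Longrightarrow> part (rectangle k r) c = (if c \<le> k then r else 0)"
  by (cases "r = 0") (auto simp: part_def rectangle_def)

lemma skew_shape_stabilization:
  assumes "is_partition mu"
  shows "(i, j) \<in> skew_shape (stabilization k mu) mu \<longleftrightarrow>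
    1 \<le> j \<and> j \<le> durfee_rank mu \<and> part (conj_partition mu) j < i \<and> i \<le> part (conj_partition mu) j + k"
  using diagram_stabilization[OF assms] diagram_iff_le_part_conj[OF assms]
  by (auto simp: skew_shape_def)

lemma tableau_content_column_tableau:
  assumes "is_partition mu" "1 \<le> c"
  shows "tableau_content (stabilization k mu) mu (column_tableau k mu) c =
    part (rectangle k (durfee_rank mu)) c"
proof -
  let ?S = "skew_shape (stabilization k mu) mu"
  have S: "{b \<in> ?S. column_tableau k mu b = c} =
      (if c \<le> k then (\<lambda>j. (part (conj_partition mu) j + c, j)) ` {1..durfee_rank mu} else {})"
    using assms(2) by (auto simp: column_tableau_def skew_shape_stabilization[OF assms(1)] image_iff)
  have "inj_on (\<lambda>j. (part (conj_partition mu) j + c, j)) {1..durfee_rank mu}"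
    by (auto simp: inj_on_def)
  then show ?thesis
    by (auto simp: tableau_content_def S part_rectangle[OF assms(2)] card_image)
qed

text \<open>Every nonempty column has exactly \<open>k\<close> boxes and only \<open>k\<close>
  labels are available, so strictness forces the filling.\<close>

lemma LR_stabilization_eq_column_tableau:
  assumes mu: "is_partition mu" and T: "T \<in> LR (stabilization k mu) mu lam" and len: "length lam \<le> k"
  shows "T = column_tableau k mu"
proof
  fix b :: "nat \<times> nat"
  obtain i j where b: "b = (i, j)" by (cases b)
  let ?S = "skew_shape (stabilization k mu) mu"
  note S = skew_shape_stabilization[OF mu]
  show "T b = column_tableau k mu b"
  proof (cases "b \<in> ?S")
    case True
    have "T (i, j) = i - part (conj_partition mu) j"
    proof (rule strict_increasing_into_interval[where f = "\<lambda>i. T (i, j)" and k = k])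
      show "T (p, j) < T (p', j)"
        if "part (conj_partition mu) j < p" "p < p'" "p' \<le> part (conj_partition mu) j + k" for p p'
        using that True b by (intro LR_column_strict[OF T]) (auto simp: S)
      show "T (p, j) \<in> {1..k}"
        if "part (conj_partition mu) j < p" "p \<le> part (conj_partition mu) j + k" for p
        using LR_label_le[OF T, of "(p, j)"] that True b len by (auto simp: S)
    qed (use True b in \<open>auto simp: S\<close>)
    then show ?thesis using True b by (simp add: column_tableau_def)
  next
    case False
    then show ?thesis
      using T PiE_arb[of T ?S "\<lambda>_. {1..}" b] by (simp add: LR_def skew_tableaux_def column_tableau_def)
  qed
qed

text \<open>The forced filling uses each label from 1 to \<open>k\<close> once in each of the first
  \<open>r\<close> columns, where \<open>r\<close> is the rank, and this content determines
  \<open>lam\<close>.\<close>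

lemma LR_stabilization_eq_rectangle:
  assumes mu: "is_partition mu" and T: "T \<in> LR (stabilization k mu) mu lam"
    and lam: "is_partition lam" "length lam \<le> k"
  shows "lam = rectangle k (durfee_rank mu)"
proof (rule part_eqI[OF lam(1) rectangle(1)])
  fix c :: nat assume "1 \<le> c"
  then show "part lam c = part (rectangle k (durfee_rank mu)) c"
    using T tableau_content_column_tableau[OF mu, of c k]
      LR_stabilization_eq_column_tableau[OF mu T lam(2)] by (auto simp: LR_def)
qed

text \<open>The word is lattice because the box above a label \<open>c + 1\<close> carries the label \<open>c\<close>.\<close>

lemma lattice_word_column_tableau:
  assumes mu: "is_partition mu"
  shows "lattice_word (reverse_reading_word (stabilization k mu) mu (column_tableau k mu))"
proof -
  let ?al = "stabilization k mu" and ?T = "column_tableau k mu"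
  define row where "row i = map (\<lambda>j. ?T (i, j)) (rev [Suc (part mu i)..<Suc (part ?al i)])" for i
  have count: "count_list (row i) c = card {j. (i, j) \<in> skew_shape ?al mu \<and> i - part (conj_partition mu) j = c}"
    if "1 \<le> i" for i c
  proof -
    have "{j \<in> set (rev [Suc (part mu i)..<Suc (part ?al i)]). ?T (i, j) = c} =
      {j. (i, j) \<in> skew_shape ?al mu \<and> i - part (conj_partition mu) j = c}"
      using that by (auto simp: column_tableau_def skew_shape_def diagram_def)
    then show ?thesis by (simp add: row_def count_list_map_distinct del: upt_Suc)
  qed
  have "lattice_word (concat (map row [1..<Suc (length ?al)]))"
  proof (rule lattice_word_concat)
    fix c :: nat assume c: "1 \<le> c"
    \<comment> \<open>A box of row 1 has position at most 1 in its column, so only the label 1 is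
      possible there.\<close>
    have "{j. (1, j) \<in> skew_shape ?al mu \<and> 1 - part (conj_partition mu) j = Suc c} = {}"
      using c by auto
    then show "count_list (row 1) (Suc c) = 0" by (simp only: count[OF order_refl] card.empty)
    fix i :: nat assume i: "1 \<le> i"
    let ?A = "\<lambda>i c. {j. (i, j) \<in> skew_shape ?al mu \<and> i - part (conj_partition mu) j = c}"
    have "?A i c \<subseteq> {1..durfee_rank mu}"
      by (auto simp: skew_shape_stabilization[OF mu])
    then have "finite (?A i c)" by (rule finite_subset) simp
    moreover have "?A (Suc i) (Suc c) \<subseteq> ?A i c"
      using c by (auto simp: skew_shape_stabilization[OF mu])
    ultimately have "card (?A (Suc i) (Suc c)) \<le> card (?A i c)" by (rule card_mono)
    then show "count_list (row (Suc i)) (Suc c) \<le> count_list (row i) c"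
      using i by (simp add: count)
  qed
  then show ?thesis by (simp add: reverse_reading_word_def row_def[abs_def])
qed

lemma column_tableau_in_LR:
  assumes mu: "is_partition mu"
  shows "column_tableau k mu \<in> LR (stabilization k mu) mu (rectangle k (durfee_rank mu))"
proof -
  let ?al = "stabilization k mu"
  note S = skew_shape_stabilization[OF mu]
  have "column_tableau k mu \<in> skew_tableaux ?al mu"
    unfolding skew_tableaux_def column_tableau_def by (intro restrict_PiE_iff[THEN iffD2]) (auto simp: S)
  moreover have "diagram mu \<subseteq> diagram ?al"
    using diagram_iff_le_part_conj[OF mu] diagram_stabilization[OF mu] by auto
  moreover have "semistandard ?al mu (column_tableau k mu)"
    unfolding semistandard_def
  proof (intro conjI allI impI)
    fix i j j' assume *: "(i, j) \<in> skew_shape ?al mu" "(i, j') \<in> skew_shape ?al mu" "j < j'"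
    \<comment> \<open>Columns of \<open>mu\<close> get shorter to the right, so a box further right
      in the same row lies deeper in its skew column.\<close>
    then have "part (conj_partition mu) j' \<le> part (conj_partition mu) j"
      using part_conj_partition[OF mu] length_filter_ge_antimono[of j j' mu] by (auto simp: S)
    then show "column_tableau k mu (i, j) \<le> column_tableau k mu (i, j')"
      using * by (auto simp: column_tableau_def)
  next
    fix i i' j assume "(i, j) \<in> skew_shape ?al mu" "(i', j) \<in> skew_shape ?al mu" "i < i'"
    then show "column_tableau k mu (i, j) < column_tableau k mu (i', j)"
      by (auto simp: column_tableau_def S)
  qed
  ultimately show ?thesis
    using lattice_word_column_tableau[OF mu] tableau_content_column_tableau[OF mu]
    by (auto simp: LR_def)
qed

section \<open>Recovering the inner shape\<close>

lemma first_columns_subset: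
  assumes "is_partition mu" "is_partition nu" "T \<in> LR (stabilization k mu) nu lam" "length lam \<le> k"
    and "j \<le> durfee_rank mu" "(i, j) \<in> diagram mu"
  shows "(i, j) \<in> diagram nu"
proof -
  \<comment> \<open>The excess of the outer column over \<open>mu\<close> is already the maximal
    \<open>k\<close>, so the column of \<open>nu\<close> cannot be shorter than that of
    \<open>mu\<close>.\<close>
  have "part (conj_partition mu) j + k = part (conj_partition (stabilization k mu)) j"
    using assms(1,5,6) part_conj_partition[OF is_partition_stabilization]
      part_conj_partition[OF assms(1)] length_filter_stabilization[of j]
    by (auto simp: diagram_def)
  also have "\<dots> \<le> part (conj_partition nu) j + k"
    using LR_column_height[OF assms(3) is_partition_stabilization assms(2), of j] assms(4) by simp
  finally show ?thesis
    using assms(6) diagram_iff_le_part_conj[OF assms(1)] diagram_iff_le_part_conj[OF assms(2)] by auto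
qed

lemma last_columns_subset:
  assumes "is_partition mu" "T \<in> LR (stabilization k mu) nu lam"
    and "durfee_rank mu < j" "(i, j) \<in> diagram nu"
  shows "(i, j) \<in> diagram mu"
proof -
  have "(i, j) \<in> diagram (stabilization k mu)" using assms(2,4) by (auto simp: LR_def)
  then show ?thesis
    using assms(3) diagram_stabilization[OF assms(1)] diagram_iff_le_part_conj[OF assms(1)] by auto
qed

lemma LR_stabilization_pair_inner_shape:
  assumes mu: "is_partition mu" and nu: "is_partition nu"
    and T: "T \<in> LR (stabilization k mu) nu lam"
    and U: "U \<in> LR (stabilization k (conj_partition mu)) (conj_partition nu) lam"
    and len: "length lam \<le> k"
  shows "nu = mu"
proof (rule diagram_inject[OF nu mu], rule set_eqI)
  let ?r = "durfee_rank mu"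
  note mu' = is_partition_conj_partition[OF mu] and nu' = is_partition_conj_partition[OF nu]
  note r' = durfee_rank_conj_partition[OF mu]
  have durfee: "(i, j) \<in> diagram mu" if "1 \<le> i" "i \<le> ?r" "1 \<le> j" "j \<le> ?r" for i j
    using that diagonal_iff_durfee_rank[OF mu, of ?r] diagram_down_closed[OF mu, of ?r ?r] by auto
  \<comment> \<open>A box beyond both row and column \<open>?r\<close> would force the diagonal box
    after the Durfee square into \<open>mu\<close>.\<close>
  have outside: "i \<le> ?r \<or> j \<le> ?r" if "(i, j) \<in> diagram mu" for i j
    using diagonal_iff_durfee_rank[OF mu, of "Suc ?r"]
      diagram_down_closed[OF mu that, of "Suc ?r" "Suc ?r"] by linarith
  fix b :: "nat \<times> nat"
  obtain i j where b: "b = (i, j)" by (cases b)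
  show "b \<in> diagram nu \<longleftrightarrow> b \<in> diagram mu"
  proof
    assume "b \<in> diagram nu"
    then have n: "(i, j) \<in> diagram nu" using b by simp
    consider "?r < j" | "?r < i" | "i \<le> ?r" "j \<le> ?r" by linarith
    then show "b \<in> diagram mu"
    proof cases
      case 1
      then show ?thesis using last_columns_subset[OF mu T _ n] b by simp
    next
      case 2
      then show ?thesis
        \<comment> \<open>Rows of \<open>nu\<close> and \<open>mu\<close> are columns of their
          conjugates, so the second tableau controls them.\<close>
        using last_columns_subset[OF mu' U, of i j] n b r'
        by (simp add: diagram_conj_partition[OF mu] diagram_conj_partition[OF nu])
    next
      case 3
      then show ?thesis using n durfee b by (auto simp: diagram_def)
    qed
  next
    assume "b \<in> diagram mu"
    then have m: "(i, j) \<in> diagram mu" using b by simp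
    from outside[OF m] show "b \<in> diagram nu"
    proof
      assume "j \<le> ?r"
      then show ?thesis using first_columns_subset[OF mu nu T len _ m] b by simp
    next
      assume "i \<le> ?r"
      then show ?thesis
        using first_columns_subset[OF mu' nu' U len, of i j] m b r'
        by (simp add: diagram_conj_partition[OF mu] diagram_conj_partition[OF nu])
    qed
  qed
qed

theorem theorem4p6:
  fixes \<alpha> \<beta> \<mu> :: "nat list" and k :: nat
  assumes "is_partition \<alpha>" and "is_partition \<beta>"
    and "sum_list \<alpha> = sum_list \<beta>"
    and "is_partition \<mu>"
    and "\<alpha> = stabilization k \<mu>"
    and "\<beta> = stabilization k (conj_partition \<mu>)"
  shows "\<exists>\<chi>. X_set \<alpha> \<beta> k = {\<chi>} \<and> pair_sign \<chi> = (-1) ^ sum_list \<mu>"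
proof -
  let ?\<mu>' = "conj_partition \<mu>"
  note \<mu> = \<open>is_partition \<mu>\<close> and \<mu>' = is_partition_conj_partition[OF \<open>is_partition \<mu>\<close>]
  define \<chi> where "\<chi> = ((rectangle k (durfee_rank \<mu>), \<mu>), (column_tableau k \<mu>, column_tableau k ?\<mu>'))"
  \<comment> \<open>Both tableaux must have the same content; they do because \<open>mu\<close> and
    its conjugate have equal rank, hence the same rectangle.\<close>
  have "\<chi> \<in> X_set \<alpha> \<beta> k"
    using column_tableau_in_LR[OF \<mu>, of k] column_tableau_in_LR[OF \<mu>', of k] rectangle \<mu>
    by (simp add: X_set_def X_pairs_def \<chi>_def assms(5,6) durfee_rank_conj_partition[OF \<mu>])
  moreover have "x = \<chi>" if "x \<in> X_set \<alpha> \<beta> k" for x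
  proof -
    obtain lam nu T U where x: "x = ((lam, nu), (T, U))" by (metis prod.exhaust)
    with that have lam: "is_partition lam" "length lam \<le> k" and nu: "is_partition nu"
      and T: "T \<in> LR (stabilization k \<mu>) nu lam"
      and U: "U \<in> LR (stabilization k ?\<mu>') (conj_partition nu) lam"
      by (auto simp: X_set_def X_pairs_def assms(5,6))
    have [simp]: "nu = \<mu>" by (rule LR_stabilization_pair_inner_shape[OF \<mu> nu T U lam(2)])
    have "lam = rectangle k (durfee_rank \<mu>)"
      using LR_stabilization_eq_rectangle[OF \<mu> _ lam] T by simp
    moreover have "T = column_tableau k \<mu>"
      using LR_stabilization_eq_column_tableau[OF \<mu> _ lam(2)] T by simp
    moreover have "U = column_tableau k ?\<mu>'"
      using LR_stabilization_eq_column_tableau[OF \<mu>' _ lam(2)] U by simp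
    ultimately show ?thesis by (simp add: x \<chi>_def)
  qed
  ultimately have "X_set \<alpha> \<beta> k = {\<chi>}" by blast
  then show ?thesis by (auto simp: \<chi>_def pair_sign_def)
qed

end
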